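(* Let $G=(V,E)$ be a connected, infinite, quasi-transitive, locally finite, simple graph with root $\mathrm{id}$, having a graph height function $(h,\mathcal H)$. Let $\Phi_E(\mathcal H)$ be the set of $\mathcal H$-invariant functions $\phi:E\to(0,\infty)$, endowed with the supremum metric $d_{\sup}(\phi,\psi)=\sup\{|\phi(e)-\psi(e)|:e\in E\}$. Then the connective constant $\mu(G,\cdot)$ and the bridge constant $\beta(G,\cdot)$ are continuous functions on $\Phi_E(\mathcal H)$. More precisely, for all $\phi,\psi\in\Phi_E(\mathcal H)$, $$1-\frac{d_{\sup}(\psi,\phi)}{\phi_{\min}}\le \frac{\mu(G,\psi)}{\mu(G,\phi)},\ \frac{\beta(G,\psi)}{\beta(G,\phi)}\le 1+\frac{d_{\sup}(\psi,\phi)}{\phi_{\min}},$$ where $\phi_{\min}=\inf\{\phi(e):e\in E\}$.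
   Context: A graph height function on $G$ is a pair $(h,\mathcal H)$ with $h:V\to\mathbb Z$, $h(\mathrm{id})=0$; $\mathcal H\le\mathrm{Aut}(G)$ acts quasi-transitively on $G$; $h(\alpha v)-h(\alpha u)=h(v)-h(u)$ for all $\alpha\in\mathcal H$, $u,v\in V$; and every $v\in V$ has neighbours $u,w$ with $h(u)<h(v)<h(w)$. $\phi$ is $\mathcal H$-invariant if $\phi(\langle\alpha u,\alpha v\rangle)=\phi(\langle u,v\rangle)$ for every edge and $\alpha\in\mathcal H$ (then $0<\phi_{\min}$). An $n$-step self-avoiding walk (SAW) is a sequence $(\pi_0,\dots,\pi_n)$ of distinct vertices with consecutive vertices adjacent; its weight is $w_\phi(\pi)=\prod_{i=1}^n\phi(\langle\pi_{i-1},\pi_i\rangle)$, and $w_\phi(\Pi)=\sum_{\pi\in\Pi}w_\phi(\pi)$. With $\Sigma_n$ the set of $n$-step SAWs from $\mathrm{id}$, the connective constant is $\mu(G,\phi)=\lim_{n\to\infty}w_\phi(\Sigma_n)^{1/n}$. A bridge is a SAW with $h(\pi_0)<h(\pi_i)\le h(\pi_n)$ for $1\le i\le n$; with $\beta_n(v)$ the set of $n$-step bridges from $v$ and $w_\phi(\beta_n)=\min_v w_\phi(\beta_n(v))$, the bridge constant is $\beta(G,\phi)=\lim_{n\to\infty}w_\phi(\beta_n)^{1/n}$. *)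

theory Defs
  imports "HOL-Analysis.Analysis" "HOL-Algebra.Bij"
begin

text \<open>A simple undirected graph is a vertex set \<open>V\<close> with a set \<open>E\<close> of two-element subsets of \<open>V\<close>;
  the edge joining \<open>u\<close> and \<open>v\<close> is \<open>{u, v}\<close>.\<close>

definition simple_graph :: "'a set \<Rightarrow> 'a set set \<Rightarrow> bool" where
  "simple_graph V E \<longleftrightarrow> (\<forall>e\<in>E. e \<subseteq> V \<and> card e = 2)"

definition connected_graph :: "'a set \<Rightarrow> 'a set set \<Rightarrow> bool" where
  "connected_graph V E \<longleftrightarrow> (\<forall>u\<in>V. \<forall>v\<in>V. (u, v) \<in> {(x, y). {x, y} \<in> E}\<^sup>*)"

definition locally_finite_graph :: "'a set \<Rightarrow> 'a set set \<Rightarrow> bool" where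
  "locally_finite_graph V E \<longleftrightarrow> (\<forall>v\<in>V. finite {u. {v, u} \<in> E})"

text \<open>The automorphism group, as a subgroup of the library's group of permutations of \<open>V\<close>
  (whose elements are extensional functions on \<open>V\<close>).\<close>

definition graph_aut :: "'a set \<Rightarrow> 'a set set \<Rightarrow> ('a \<Rightarrow> 'a) monoid" where
  "graph_aut V E = BijGroup V
     \<lparr>carrier := {\<alpha> \<in> Bij V. \<forall>u\<in>V. \<forall>v\<in>V. {\<alpha> u, \<alpha> v} \<in> E \<longleftrightarrow> {u, v} \<in> E}\<rparr>"

definition quasi_transitive_action :: "'a set \<Rightarrow> ('a \<Rightarrow> 'a) set \<Rightarrow> bool" where
  "quasi_transitive_action V H \<longleftrightarrow> (\<exists>W. finite W \<and> W \<subseteq> V \<and> (\<forall>v\<in>V. \<exists>\<alpha>\<in>H. \<alpha> v \<in> W))"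

definition quasi_transitive_graph :: "'a set \<Rightarrow> 'a set set \<Rightarrow> bool" where
  "quasi_transitive_graph V E \<longleftrightarrow> quasi_transitive_action V (carrier (graph_aut V E))"

definition graph_height_function ::
  "'a set \<Rightarrow> 'a set set \<Rightarrow> 'a \<Rightarrow> ('a \<Rightarrow> int) \<Rightarrow> ('a \<Rightarrow> 'a) set \<Rightarrow> bool" where
  "graph_height_function V E r h H \<longleftrightarrow>
     h r = 0 \<and>
     subgroup H (graph_aut V E) \<and>
     quasi_transitive_action V H \<and>
     (\<forall>\<alpha>\<in>H. \<forall>u\<in>V. \<forall>v\<in>V. h (\<alpha> v) - h (\<alpha> u) = h v - h u) \<and>
     (\<forall>v\<in>V. \<exists>u w. {v, u} \<in> E \<and> {v, w} \<in> E \<and> h u < h v \<and> h v < h w)"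

text \<open>The space \<open>\<Phi>\<^sub>E(H)\<close>. Its elements are extensional on \<open>E\<close>, so that two weight functions
  agreeing on every edge are equal and the supremum distance separates points.\<close>

definition weight_functions :: "'a set set \<Rightarrow> ('a \<Rightarrow> 'a) set \<Rightarrow> ('a set \<Rightarrow> real) set" where
  "weight_functions E H =
     {\<phi> \<in> E \<rightarrow>\<^sub>E {0<..}. \<forall>\<alpha>\<in>H. \<forall>u v. {u, v} \<in> E \<longrightarrow> \<phi> {\<alpha> u, \<alpha> v} = \<phi> {u, v}}"

definition dsup :: "'a set set \<Rightarrow> ('a set \<Rightarrow> real) \<Rightarrow> ('a set \<Rightarrow> real) \<Rightarrow> real" where
  "dsup E \<phi> \<psi> = (SUP e\<in>E. \<bar>\<phi> e - \<psi> e\<bar>)"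

text \<open>\<open>\<Phi>\<^sub>E(H)\<close> with the supremum metric, as a subspace of the library's space of bounded functions
  on \<open>E\<close>. Under the standing hypotheses every element of \<open>\<Phi>\<^sub>E(H)\<close> is bounded and the distance
  is \<open>dsup\<close>; see \<open>mspace_weight_metric\<close> and \<open>mdist_weight_metric\<close> below.\<close>

definition weight_metric :: "'a set set \<Rightarrow> ('a \<Rightarrow> 'a) set \<Rightarrow> ('a set \<Rightarrow> real) metric" where
  "weight_metric E H = submetric (funspace E euclidean_metric) (weight_functions E H)"

definition weight_min :: "'a set set \<Rightarrow> ('a set \<Rightarrow> real) \<Rightarrow> real" where
  "weight_min E \<phi> = (INF e\<in>E. \<phi> e)"

text \<open>A walk with \<open>n\<close> steps is the list of its \<open>n + 1\<close> vertices.\<close>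

definition saws :: "'a set \<Rightarrow> 'a set set \<Rightarrow> nat \<Rightarrow> 'a \<Rightarrow> 'a list set" where
  "saws V E n v = {\<pi>. length \<pi> = Suc n \<and> set \<pi> \<subseteq> V \<and> \<pi> ! 0 = v \<and> distinct \<pi> \<and>
                      (\<forall>i<n. {\<pi> ! i, \<pi> ! Suc i} \<in> E)}"

definition bridges ::
  "'a set \<Rightarrow> 'a set set \<Rightarrow> ('a \<Rightarrow> int) \<Rightarrow> nat \<Rightarrow> 'a \<Rightarrow> 'a list set" where
  "bridges V E h n v =
     {\<pi> \<in> saws V E n v. \<forall>i\<in>{1..n}. h (\<pi> ! 0) < h (\<pi> ! i) \<and> h (\<pi> ! i) \<le> h (\<pi> ! n)}"

definition walk_weight :: "('a set \<Rightarrow> real) \<Rightarrow> 'a list \<Rightarrow> real" where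
  "walk_weight \<phi> \<pi> = (\<Prod>i=1..length \<pi> - 1. \<phi> {\<pi> ! (i - 1), \<pi> ! i})"

definition total_weight :: "('a set \<Rightarrow> real) \<Rightarrow> 'a list set \<Rightarrow> real" where
  "total_weight \<phi> P = (\<Sum>\<pi>\<in>P. walk_weight \<phi> \<pi>)"

definition connective_const ::
  "'a set \<Rightarrow> 'a set set \<Rightarrow> 'a \<Rightarrow> ('a set \<Rightarrow> real) \<Rightarrow> real" where
  "connective_const V E r \<phi> = lim (\<lambda>n. root n (total_weight \<phi> (saws V E n r)))"

text \<open>The minimum over starting vertices is written as an infimum; it is attained because, for
  invariant weights, only finitely many values occur.\<close>

definition min_bridge_weight ::
  "'a set \<Rightarrow> 'a set set \<Rightarrow> ('a \<Rightarrow> int) \<Rightarrow> ('a set \<Rightarrow> real) \<Rightarrow> nat \<Rightarrow> real" where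
  "min_bridge_weight V E h \<phi> n = (INF v\<in>V. total_weight \<phi> (bridges V E h n v))"

definition bridge_const ::
  "'a set \<Rightarrow> 'a set set \<Rightarrow> ('a \<Rightarrow> int) \<Rightarrow> ('a set \<Rightarrow> real) \<Rightarrow> real" where
  "bridge_const V E h \<phi> = lim (\<lambda>n. root n (min_bridge_weight V E h \<phi> n))"

text \<open>An invariant weight function takes only finitely many values, so the supremum in \<open>dsup\<close> and
  the infimum in \<open>weight_min\<close> are those of bounded sets, and \<open>weight_min\<close> is positive.\<close>

lemma finite_weight_values:
  assumes G: "simple_graph V E" "locally_finite_graph V E" "graph_height_function V E r h H"
    and \<phi>: "\<phi> \<in> weight_functions E H"
  shows "finite (\<phi> ` E)"
proof -
  have "quasi_transitive_action V H" and sub: "subgroup H (graph_aut V E)"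
    using G(3) by (simp_all only: graph_height_function_def)
  then obtain W where W: "finite W" "W \<subseteq> V" "\<forall>v\<in>V. \<exists>\<alpha>\<in>H. \<alpha> v \<in> W"
    unfolding quasi_transitive_action_def by metis
  have H: "H \<subseteq> carrier (graph_aut V E)"
    using sub by (rule subgroup.subset)
  define F where "F = (\<Union>w\<in>W. (\<lambda>x. {w, x}) ` {x. {w, x} \<in> E})"
  have "finite F"
    unfolding F_def
    by (intro finite_UN_I finite_imageI) (use W(1,2) G(2) in \<open>auto simp: locally_finite_graph_def\<close>)
  moreover have "\<phi> ` E \<subseteq> \<phi> ` F"
  proof
    fix y assume "y \<in> \<phi> ` E"
    then obtain e where e: "e \<in> E" "y = \<phi> e" by blast
    then have "e \<subseteq> V" "card e = 2" using G(1) unfolding simple_graph_def by auto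
    then obtain u v where uv: "e = {u, v}" "u \<in> V" "v \<in> V"
      by (auto simp: card_2_iff)
    obtain \<alpha> where \<alpha>: "\<alpha> \<in> H" "\<alpha> u \<in> W" using bspec[OF W(3) uv(2)] by (rule bexE)
    have uvE: "{u, v} \<in> E" using e(1) uv(1) by simp
    have "\<alpha> \<in> carrier (graph_aut V E)" using \<alpha>(1) H by (rule rev_subsetD)
    then have "\<forall>u\<in>V. \<forall>v\<in>V. {\<alpha> u, \<alpha> v} \<in> E \<longleftrightarrow> {u, v} \<in> E"
      by (simp add: graph_aut_def)
    then have "{\<alpha> u, \<alpha> v} \<in> E" using uv(2,3) uvE by (simp only:)
    then have F: "{\<alpha> u, \<alpha> v} \<in> F" using \<alpha>(2) unfolding F_def by auto
    have "\<forall>\<alpha>\<in>H. \<forall>u v. {u, v} \<in> E \<longrightarrow> \<phi> {\<alpha> u, \<alpha> v} = \<phi> {u, v}"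
      using \<phi> by (simp add: weight_functions_def)
    then have "\<phi> {\<alpha> u, \<alpha> v} = \<phi> {u, v}" using \<alpha>(1) uvE by (simp only:)
    then have "y = \<phi> {\<alpha> u, \<alpha> v}" using e(2) uv(1) by simp
    then show "y \<in> \<phi> ` F" using F by (rule image_eqI)
  qed
  ultimately show ?thesis by (meson finite_imageI finite_subset)
qed

lemma mspace_weight_metric:
  assumes "simple_graph V E" "locally_finite_graph V E" "graph_height_function V E r h H"
  shows "mspace (weight_metric E H) = weight_functions E H"
proof -
  have "bounded (\<phi> ` E)" if "\<phi> \<in> weight_functions E H" for \<phi>
    by (rule finite_imp_bounded[OF finite_weight_values[OF assms that]])
  then show ?thesis
    by (auto simp: weight_metric_def Met_TC.fspace_def weight_functions_def PiE_def)
qed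

lemma mdist_weight_metric:
  assumes "simple_graph V E" "locally_finite_graph V E" "graph_height_function V E r h H"
    and "E \<noteq> {}" "\<phi> \<in> weight_functions E H" "\<psi> \<in> weight_functions E H"
  shows "mdist (weight_metric E H) \<phi> \<psi> = dsup E \<phi> \<psi>"
proof -
  have "\<phi> \<in> mspace (weight_metric E H)" "\<psi> \<in> mspace (weight_metric E H)"
    using assms by (simp_all add: mspace_weight_metric)
  then show ?thesis
    using \<open>E \<noteq> {}\<close> by (simp add: weight_metric_def Met_TC.fdist_def dsup_def dist_real_def)
qed

end

theory Submission
  imports Defs
begin

text \<open>If \<open>t = dsup \<psi> \<phi> / weight_min \<phi>\<close>, then \<open>(1 - t) \<phi> \<le> \<psi> \<le> (1 + t) \<phi>\<close> on every edge, so the weights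
  of an \<open>n\<close>-step walk under \<open>\<phi>\<close> and \<open>\<psi>\<close> compare with constants \<open>(1 - t)\<^sup>n\<close> and \<open>(1 + t)\<^sup>n\<close>; summing and
  taking \<open>n\<close>-th roots gives the bounds, and these give continuity. The real content is that both
  limits exist and are positive. Bridges can be concatenated, so \<open>min_bridge_weight\<close> is
  supermultiplicative and Fekete's lemma applies. For self-avoiding walks Fekete's lemma applies only
  to the maximum over starting points. Following Hammersley, if the weight from \<open>u\<close> falls
  exponentially below that maximum at length \<open>N\<close>, then the weight from any neighbour of \<open>u\<close> does so at
  length \<open>2N\<close>. After boundedly many steps this holds at one common length for a representative of
  every orbit, which contradicts the lower bound on the maximum.\<close>

section \<open>Fekete's lemma\<close>

text \<open>Split off blocks of length \<open>m\<close>: each costs a factor at most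
  \<open>x ^ m\<close>, and only a remainder of length below \<open>m\<close> is left over.\<close>

lemma submultiplicative_upper:
  fixes f :: "nat \<Rightarrow> real"
  assumes sub: "\<And>m n. f (m + n) \<le> f m * f n" and pos: "\<And>n. 0 \<le> f n"
    and m: "0 < m" "f m \<le> x ^ m" and x: "0 < x"
  obtains C where "0 < C" "\<And>n. f n \<le> C * x ^ n"
proof -
  \<comment> \<open>The sum covers every possible remainder \<open>j < m\<close>; the summand 1
    keeps \<open>C\<close> positive when all these \<open>f j\<close> vanish.\<close>
  define C where "C = 1 + (\<Sum>j<m. f j / x ^ j)"
  have C: "1 \<le> C" unfolding C_def using pos x by (simp add: sum_nonneg)
  have "f n \<le> C * x ^ n" for n
  proof (induction n rule: less_induct)
    case (less n)
    show ?case
    proof (cases "n < m")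
      case True
      have "f n / x ^ n \<le> (\<Sum>j<m. f j / x ^ j)"
        by (rule member_le_sum) (use True pos x in auto)
      then have "f n / x ^ n \<le> C" by (simp add: C_def)
      then show ?thesis using x by (simp add: field_simps)
    next
      case False
      then have n: "n = m + (n - m)" by simp
      have "f n \<le> f m * f (n - m)" using sub[of m "n - m"] n by simp
      also have "\<dots> \<le> x ^ m * (C * x ^ (n - m))"
        by (intro mult_mono less.IH m(2)) (use m(1) False pos x in auto)
      also have "\<dots> = C * x ^ n" using n by (metis mult.left_commute power_add)
      finally show ?thesis .
    qed
  qed
  with that[of C] C show ?thesis by simp
qed

text \<open>The two sides are asymmetric on purpose. Hammersley's argument yields lower bounds only
  eventually and with a loss \<open>q ^ n\<close>, while submultiplicativity yields upper bounds
  with a constant, which the root sends to 1.\<close>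

lemma root_tendsto_sandwich:
  fixes f :: "nat \<Rightarrow> real"
  assumes L: "0 < L"
    and lower: "\<And>q. 0 < q \<Longrightarrow> q < 1 \<Longrightarrow> \<forall>\<^sub>F n in sequentially. (q * L) ^ n \<le> f n"
    and upper: "\<And>x. L < x \<Longrightarrow> \<exists>C>0. \<forall>n. f n \<le> C * x ^ n"
  shows "(\<lambda>n. root n (f n)) \<longlonglongrightarrow> L"
proof (rule order_tendstoI)
  fix a assume a: "a < L"
  \<comment> \<open>The midpoint between \<open>a / L\<close> and 1 gives \<open>a < q * L\<close>;
    the \<open>max\<close> keeps \<open>q\<close> positive when \<open>a\<close> is
    negative.\<close>
  define q where "q = (max 0 (a / L) + 1) / 2"
  have q: "0 < q" "q < 1" "a < q * L"
    using a L by (auto simp: q_def max_def field_simps)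
  show "\<forall>\<^sub>F n in sequentially. a < root n (f n)"
    using lower[OF q(1,2)] eventually_gt_at_top[of 0]
  proof eventually_elim
    case (elim n)
    have "root n ((q * L) ^ n) \<le> root n (f n)" using elim by simp
    then show ?case using elim q L by (simp add: real_root_power_cancel)
  qed
next
  fix a assume a: "L < a"
  define x where "x = (L + a) / 2"
  have x: "L < x" "x < a" "0 < x" using a L by (auto simp: x_def)
  obtain C where C: "C > 0" "\<And>n. f n \<le> C * x ^ n" using upper[OF x(1)] by blast
  have "(\<lambda>n. root n C * x) \<longlonglongrightarrow> 1 * x"
    by (intro tendsto_intros LIMSEQ_root_const C)
  then have "\<forall>\<^sub>F n in sequentially. root n C * x < a"
    using x by (intro order_tendstoD) auto
  then show "\<forall>\<^sub>F n in sequentially. root n (f n) < a"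
    using eventually_gt_at_top[of 0]
  proof eventually_elim
    case (elim n)
    have "root n (f n) \<le> root n (C * x ^ n)" using elim C by simp
    also have "\<dots> = root n C * x" using elim x by (simp add: real_root_mult real_root_power_cancel)
    finally show ?case using elim by simp
  qed
qed

text \<open>The limit is the infimum of the roots, kept positive by \<open>l\<close>. The bounds
  \<open>L ^ n \<le> f n\<close> for every \<open>n\<close> and \<open>C * x ^ n\<close> are
  exported as well, because Hammersley's argument uses them and not just the limit.\<close>

lemma submultiplicative_limit:
  fixes f :: "nat \<Rightarrow> real"
  assumes sub: "\<And>m n. f (m + n) \<le> f m * f n" and l: "0 < l" "\<And>n. l ^ n \<le> f n"
  obtains L where "l \<le> L" "\<And>n. L ^ n \<le> f n" "\<And>x. L < x \<Longrightarrow> \<exists>C>0. \<forall>n. f n \<le> C * x ^ n"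
    "(\<lambda>n. root n (f n)) \<longlonglongrightarrow> L"
proof -
  have pos: "0 < f n" for n using l(1) l(2)[of n] by (meson less_le_trans zero_less_power)
  \<comment> \<open>The index starts at 1 since \<open>root 0\<close> is constantly 0.\<close>
  define L where "L = (INF n\<in>{1..}. root n (f n))"
  have lroot: "l \<le> root n (f n)" if "n \<in> {1..}" for n
  proof -
    have "root n (l ^ n) \<le> root n (f n)" using that l by simp
    then show ?thesis using that l by (simp add: real_root_power_cancel)
  qed
  have bdd: "bdd_below ((\<lambda>n. root n (f n)) ` {1..})" using lroot by (rule bdd_belowI2)
  have lL: "l \<le> L" unfolding L_def by (rule cINF_greatest) (use lroot in auto)
  have low: "L ^ n \<le> f n" for n
  proof (cases "n = 0")
    case False
    then have "L \<le> root n (f n)" unfolding L_def by (intro cINF_lower[OF bdd]) auto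
    then have "L ^ n \<le> root n (f n) ^ n" using lL l by (intro power_mono) auto
    then show ?thesis using False pos[of n] by simp
  qed (use l(2)[of 0] in simp)
  have up: "\<exists>C>0. \<forall>n. f n \<le> C * x ^ n" if x: "L < x" for x
  proof -
    have "\<exists>n\<in>{1..}. root n (f n) < x"
      using x cINF_less_iff[OF _ bdd] unfolding L_def by auto
    then obtain m where m: "m > 0" "root m (f m) < x" by (auto simp: Suc_le_eq)
    then have "root m (f m) ^ m \<le> x ^ m" using pos[of m] by (intro power_mono) auto
    then have "f m \<le> x ^ m" using m pos[of m] by simp
    then show ?thesis
      using submultiplicative_upper[of f m x] sub pos m x lL l by (metis less_imp_le less_le_trans)
  qed
  have "(\<lambda>n. root n (f n)) \<longlonglongrightarrow> L"
  proof (rule root_tendsto_sandwich[OF _ _ up])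
    show "\<forall>\<^sub>F n in sequentially. (q * L) ^ n \<le> f n" if "0 < q" "q < 1" for q
    proof (intro always_eventually allI)
      fix n
      have "(q * L) ^ n \<le> L ^ n" using that lL l by (intro power_mono) (auto simp: mult_left_le_one_le)
      then show "(q * L) ^ n \<le> f n" using low[of n] by linarith
    qed
  qed (use lL l in auto)
  with that lL low up show ?thesis by blast
qed

text \<open>Absorbs the linear factor that comes from summing over all places where a walk can be
  cut.\<close>

lemma linear_times_power_eventually_le:
  fixes p p' A B :: real
  assumes "0 < p" "p < p'"
  shows "\<forall>\<^sub>F n in sequentially. (A + B * real n) * p ^ n \<le> p' ^ n"
proof -
  let ?x = "p / p'"
  have x: "0 < ?x" "?x < 1" using assms by auto
  have "(\<lambda>n. A * ?x ^ n + B * (real n * ?x ^ n)) \<longlonglongrightarrow> A * 0 + B * 0"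
    by (intro tendsto_intros LIMSEQ_realpow_zero powser_times_n_limit_0) (use x in auto)
  then have "\<forall>\<^sub>F n in sequentially. A * ?x ^ n + B * (real n * ?x ^ n) < 1"
    by (rule order_tendstoD) auto
  then show ?thesis
  proof eventually_elim
    case (elim n)
    have "(A + B * real n) * p ^ n = (A * ?x ^ n + B * (real n * ?x ^ n)) * p' ^ n"
      using assms by (simp add: field_simps)
    also have "\<dots> \<le> 1 * p' ^ n" using elim assms by (intro mult_right_mono) auto
    finally show ?case by simp
  qed
qed

section \<open>Hammersley's argument\<close>

text \<open>\<open>a v n\<close> is the weight of the \<open>n\<close>-step walks from \<open>v\<close>, divided by the \<open>n\<close>-th power of
  the growth rate of the maximum over \<open>v\<close>, and \<open>s\<close> is that maximum. The relation \<open>R\<close> is adjacency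
  with loops added, so that the powers of \<open>R\<close> increase.\<close>

locale hammersley =
  fixes a :: "'v \<Rightarrow> nat \<Rightarrow> real" and s :: "nat \<Rightarrow> real" and R :: "('v \<times> 'v) set" and K :: real
  assumes nonneg: "0 \<le> a v n" and K: "0 \<le> K"
    and s_pos: "0 < s n"
    and le_s: "(u, v) \<in> R \<Longrightarrow> a u n \<le> s n"
    and split: "(u, v) \<in> R \<Longrightarrow> a u (m + n) \<le> a u m * s n"
    and adjacent: "(u, v) \<in> R \<Longrightarrow> a v n \<le> K * a u (Suc n) + (\<Sum>k\<le>n. a u k * a u (n - k))"
    and subexp: "1 < x \<Longrightarrow> \<exists>C>0. \<forall>n. s n \<le> C * x ^ n"
begin

text \<open>Apply \<open>adjacent\<close> with \<open>n = 2 * N\<close>. In every product one factor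
  has length at least \<open>N\<close>, and so has the walk of length \<open>2 * N + 1\<close>; by
  \<open>split\<close> each term therefore inherits the factor \<open>q ^ N\<close>, and what
  remains grows slower than any prescribed exponential. The threshold for \<open>N\<close> depends
  on \<open>q\<close> only, not on \<open>u\<close> and \<open>v\<close>.\<close>

lemma slow_step:
  assumes q: "0 < q" "q < 1"
  obtains q' where "0 < q'" "q' < 1"
    "\<forall>\<^sub>F N in sequentially. \<forall>(u, v)\<in>R. a u N \<le> q ^ N \<longrightarrow> a v (2 * N) \<le> q' ^ (2 * N)"
proof -
  \<comment> \<open>The growth allowed for \<open>s\<close> is chosen so that
    \<open>q * x = sqrt q\<close> is still below 1.\<close>
  define x where "x = 1 / sqrt q"
  have x: "1 < x" using q by (simp add: x_def)
  \<comment> \<open>An eighth root: \<open>q' ^ (2 * N)\<close> is the \<open>N\<close>-th power of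
    \<open>sqrt (sqrt q)\<close>, which exceeds \<open>sqrt q\<close> and so leaves room for the
    linear factor.\<close>
  define q' where "q' = sqrt (sqrt (sqrt q))"
  have q': "0 < q'" "q' < 1" using q by (auto simp: q'_def)
  have qx: "q * x = sqrt q" using q by (simp add: x_def real_div_sqrt)
  have q2: "q' ^ (2 * N) = sqrt (sqrt q) ^ N" for N
    using q by (simp add: q'_def power_mult)
  have lt: "0 < sqrt q" "sqrt q < sqrt (sqrt q)"
    using q by (auto intro: real_less_rsqrt simp: power2_eq_square)
  obtain C where C: "C > 0" "\<And>n. s n \<le> C * x ^ n" using subexp[OF x] by blast
  have "\<forall>\<^sub>F N in sequentially. ((K * C * x + C\<^sup>2) + (2 * C\<^sup>2) * real N) * sqrt q ^ N \<le> sqrt (sqrt q) ^ N"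
    by (rule linear_times_power_eventually_le[OF lt])
  then have "\<forall>\<^sub>F N in sequentially. \<forall>(u, v)\<in>R. a u N \<le> q ^ N \<longrightarrow> a v (2 * N) \<le> q' ^ (2 * N)"
  proof eventually_elim
    case (elim N)
    have "a v (2 * N) \<le> q' ^ (2 * N)" if R: "(u, v) \<in> R" and slow: "a u N \<le> q ^ N" for u v
    proof -
      have late: "a u (N + j) \<le> q ^ N * (C * x ^ j)" for j
      proof -
        have "a u (N + j) \<le> a u N * s j" by (rule split[OF R])
        also have "\<dots> \<le> q ^ N * (C * x ^ j)"
          by (intro mult_mono slow C) (use q s_pos[of j] in auto)
        finally show ?thesis .
      qed
      have any: "a u j \<le> C * x ^ j" for j using le_s[OF R, of j] C(2)[of j] by linarith
      let ?M = "C\<^sup>2 * (q * x) ^ N"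
      \<comment> \<open>The longer factor has length \<open>N + j\<close> and the shorter one
        \<open>k\<close>; the excess \<open>j\<close> and \<open>k\<close> add up to
        \<open>N\<close>, so \<open>x\<close> occurs exactly \<open>N\<close> times.\<close>
      have prod: "a u (N + j) * a u k \<le> ?M" if "j + k = N" for j k
      proof -
        have "a u (N + j) * a u k \<le> (q ^ N * (C * x ^ j)) * (C * x ^ k)"
          by (intro mult_mono late any nonneg) (use q C x in auto)
        also have "\<dots> = C\<^sup>2 * q ^ N * x ^ (j + k)" by (simp add: power_add power2_eq_square)
        also have "\<dots> = ?M" using that by (simp add: power_mult_distrib)
        finally show ?thesis .
      qed
      have "a u k * a u (2 * N - k) \<le> ?M" if "k \<le> 2 * N" for k
      proof (cases "N \<le> k")
        case True
        then show ?thesis using prod[of "k - N" "2 * N - k"] that by simp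
      next
        case False
        then have "2 * N - k = N + (N - k)" by simp
        then show ?thesis using prod[of "N - k" k] False by (simp add: mult.commute)
      qed
      then have "(\<Sum>k\<le>2 * N. a u k * a u (2 * N - k)) \<le> (\<Sum>k\<le>2 * N. ?M)"
        by (intro sum_mono) auto
      moreover have "a u (Suc (2 * N)) \<le> C * x * (q * x) ^ N"
        using late[of "Suc N"] by (simp add: power_mult_distrib mult_2 mult_2_right mult_ac)
      then have "K * a u (Suc (2 * N)) \<le> K * (C * x * (q * x) ^ N)"
        using K by (rule mult_left_mono)
      ultimately have "a v (2 * N) \<le> K * (C * x * (q * x) ^ N) + (\<Sum>k\<le>2 * N. ?M)"
        using adjacent[OF R, of "2 * N"] by linarith
      also have "\<dots> = ((K * C * x + C\<^sup>2) + (2 * C\<^sup>2) * real N) * sqrt q ^ N"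
        by (simp add: qx algebra_simps)
      also have "\<dots> \<le> q' ^ (2 * N)" using elim by (simp only: q2)
      finally show ?thesis .
    qed
    then show ?case by blast
  qed
  with that q' show ?thesis by blast
qed

text \<open>Induction on the number of steps; each one doubles the length and weakens the rate, but
  the new rate depends only on \<open>q\<close> and \<open>D\<close>.\<close>

lemma slow_steps:
  assumes "0 < q" "q < 1"
  shows "\<exists>q'. 0 < q' \<and> q' < 1 \<and> (\<forall>\<^sub>F N in sequentially.
    \<forall>(u, v)\<in>R ^^ D. a u N \<le> q ^ N \<longrightarrow> a v (2 ^ D * N) \<le> q' ^ (2 ^ D * N))"
proof (induction D)
  case 0
  show ?case using assms by (intro exI[of _ q]) (auto intro!: always_eventually)
next
  case (Suc D)
  then obtain q1 where q1: "0 < q1" "q1 < 1" and ev1: "\<forall>\<^sub>F N in sequentially.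
    \<forall>(u, v)\<in>R ^^ D. a u N \<le> q ^ N \<longrightarrow> a v (2 ^ D * N) \<le> q1 ^ (2 ^ D * N)" by blast
  obtain q2 where q2: "0 < q2" "q2 < 1" and ev2:
    "\<forall>\<^sub>F N in sequentially. \<forall>(u, v)\<in>R. a u N \<le> q1 ^ N \<longrightarrow> a v (2 * N) \<le> q2 ^ (2 * N)"
    by (rule slow_step[OF q1])
  \<comment> \<open>The last step is taken at the length \<open>2 ^ D * N\<close> reached after
    \<open>D\<close> steps, so its threshold has to be met there.\<close>
  have "filterlim (\<lambda>N. 2 ^ D * N :: nat) sequentially sequentially"
    by (rule filterlim_at_top_mono[OF filterlim_ident]) auto
  from eventually_compose_filterlim[OF ev2 this] ev1
  have "\<forall>\<^sub>F N in sequentially.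
    \<forall>(u, v)\<in>R ^^ Suc D. a u N \<le> q ^ N \<longrightarrow> a v (2 ^ Suc D * N) \<le> q2 ^ (2 ^ Suc D * N)"
  proof eventually_elim
    case (elim N)
    then show ?case by (fastforce simp: mult.assoc)
  qed
  with q2 show ?case by blast
qed

lemma eventually_fast:
  assumes W: "finite W" and maximal: "\<And>n. \<exists>w\<in>W. 1 \<le> a w n"
    and reach: "\<And>w. w \<in> W \<Longrightarrow> (r, w) \<in> R\<^sup>*" and loops: "\<And>u v. (u, v) \<in> R \<Longrightarrow> (v, v) \<in> R"
    and r: "(r, r) \<in> R" and q: "0 < q" "q < 1"
  shows "\<forall>\<^sub>F n in sequentially. q ^ n \<le> a r n"
proof -
  \<comment> \<open>Paths are padded with loops at their end \<open>w\<close>; for the empty path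
    that loop is the one at \<open>r\<close>.\<close>
  have mono: "(r, w) \<in> R ^^ (d + k)" if "(r, w) \<in> R ^^ d" for w d k
  proof -
    have "(w, w) \<in> R" using that r loops by (cases d) auto
    then show ?thesis using that by (induction k) auto
  qed
  have "\<forall>w\<in>W. \<exists>d. (r, w) \<in> R ^^ d" using reach by (auto dest: rtrancl_imp_relpow)
  then obtain d where d: "\<And>w. w \<in> W \<Longrightarrow> (r, w) \<in> R ^^ d w" by metis
  \<comment> \<open>Any common upper bound of the finitely many \<open>d w\<close> serves; the sum
    is one.\<close>
  define D where "D = (\<Sum>w\<in>W. d w)"
  have D: "(r, w) \<in> R ^^ D" if "w \<in> W" for w
  proof -
    have "d w \<le> D" unfolding D_def by (rule member_le_sum) (use that W in auto)
    then show ?thesis using mono[OF d[OF that], of "D - d w"] by simp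
  qed
  obtain q' where q': "0 < q'" "q' < 1" and ev: "\<forall>\<^sub>F N in sequentially.
    \<forall>(u, v)\<in>R ^^ D. a u N \<le> q ^ N \<longrightarrow> a v (2 ^ D * N) \<le> q' ^ (2 ^ D * N)"
    using slow_steps[OF q] by blast
  show ?thesis
    using ev eventually_gt_at_top[of 0]
  proof eventually_elim
    case (elim N)
    show ?case
    proof (rule ccontr)
      assume "\<not> q ^ N \<le> a r N"
      then have small: "a w (2 ^ D * N) \<le> q' ^ (2 ^ D * N)" if "w \<in> W" for w
        using elim D[OF that] by fastforce
      \<comment> \<open>Since \<open>N\<close> is positive the bound is strictly below 1, so no
        element of \<open>W\<close> attains the value required by \<open>maximal\<close>.\<close>
      have "q' ^ (2 ^ D * N) < 1" using q' elim by (intro power_Suc_less_one power_less_one_iff[THEN iffD2]) auto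
      then show False using small maximal[of "2 ^ D * N"] by fastforce
    qed
  qed
qed

end

section \<open>Walks and bridges\<close>

lemma walk_weight_single [simp]: "walk_weight \<phi> [x] = 1"
  by (simp add: walk_weight_def)

lemma walk_weight_Cons [simp]: "walk_weight \<phi> (x # y # \<pi>) = \<phi> {x, y} * walk_weight \<phi> (y # \<pi>)"
proof -
  have "walk_weight \<phi> (x # y # \<pi>) = (\<Prod>i=Suc 0..Suc (length \<pi>). \<phi> {(x # y # \<pi>) ! (i - 1), (x # y # \<pi>) ! i})"
    by (simp add: walk_weight_def)
  also have "\<dots> = \<phi> {x, y} * (\<Prod>i=Suc (Suc 0)..Suc (length \<pi>). \<phi> {(x # y # \<pi>) ! (i - 1), (x # y # \<pi>) ! i})"
    by (subst prod.atLeast_Suc_atMost) auto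
  also have "(\<Prod>i=Suc (Suc 0)..Suc (length \<pi>). \<phi> {(x # y # \<pi>) ! (i - 1), (x # y # \<pi>) ! i}) =
      (\<Prod>i=Suc 0..length \<pi>. \<phi> {(y # \<pi>) ! (i - 1), (y # \<pi>) ! i})"
    by (subst prod.atLeast_Suc_atMost_Suc_shift) (auto intro!: prod.cong simp: nth_Cons')
  finally show ?thesis by (simp add: walk_weight_def)
qed

text \<open>The cut vertex \<open>x\<close> ends one part and starts the other, so every edge lies
  in exactly one part.\<close>

lemma walk_weight_append:
  "walk_weight \<phi> (ps @ x # qs) = walk_weight \<phi> (ps @ [x]) * walk_weight \<phi> (x # qs)"
proof (induction ps)
  case (Cons p ps)
  then show ?case by (cases ps) simp_all
qed simp

lemma walk_weight_rev: "walk_weight \<phi> (rev \<pi>) = walk_weight \<phi> \<pi>"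
proof (induction \<pi> rule: induct_list012)
  case (3 x y zs)
  have "walk_weight \<phi> (rev (x # y # zs)) = walk_weight \<phi> (rev zs @ [y]) * walk_weight \<phi> [y, x]"
    using walk_weight_append[of \<phi> "rev zs" y "[x]"] by simp
  then show ?case using 3 by (simp add: insert_commute)
qed simp_all

lemma walk_weight_nonneg:
  assumes "\<And>e. e \<in> E \<Longrightarrow> 0 \<le> \<phi> e"
  shows "successively (\<lambda>x y. {x, y} \<in> E) \<pi> \<Longrightarrow> 0 \<le> walk_weight \<phi> \<pi>"
  \<comment> \<open>The empty list is an induction case although it is no walk; its weight is the
    empty product 1.\<close>
  by (induction \<pi> rule: induct_list012) (simp_all add: walk_weight_def[of _ "[]"] assms)

lemma walk_weight_le:
  assumes \<phi>\<psi>: "\<And>e. e \<in> E \<Longrightarrow> 0 \<le> \<phi> e" "\<And>e. e \<in> E \<Longrightarrow> 0 \<le> \<psi> e" "\<And>e. e \<in> E \<Longrightarrow> \<psi> e \<le> c * \<phi> e"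
    and c: "0 \<le> c"
  shows "successively (\<lambda>x y. {x, y} \<in> E) \<pi> \<Longrightarrow> walk_weight \<psi> \<pi> \<le> c ^ (length \<pi> - 1) * walk_weight \<phi> \<pi>"
proof (induction \<pi> rule: induct_list012)
  case (3 x y zs)
  have "\<psi> {x, y} * walk_weight \<psi> (y # zs)
      \<le> (c * \<phi> {x, y}) * (c ^ (length (y # zs) - 1) * walk_weight \<phi> (y # zs))"
    using 3 by (intro mult_mono "3.IH"(2) \<phi>\<psi> walk_weight_nonneg[OF \<phi>\<psi>(2)] mult_nonneg_nonneg c) auto
  then show ?case by (simp add: mult_ac)
qed (simp_all add: walk_weight_def[of _ "[]"])

text \<open>Replaces indices by \<open>hd\<close> and \<open>successively\<close>, so that walks can
  be cut, joined and reversed as lists.\<close>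

lemma saws_iff:
  "\<pi> \<in> saws V E n v \<longleftrightarrow> length \<pi> = Suc n \<and> set \<pi> \<subseteq> V \<and> hd \<pi> = v \<and> distinct \<pi> \<and>
     successively (\<lambda>x y. {x, y} \<in> E) \<pi>"
  unfolding saws_def by (cases \<pi>) (auto simp: successively_conv_nth)

lemma saws_0: "saws V E 0 v = (if v \<in> V then {[v]} else {})"
  by (auto simp: saws_iff length_Suc_conv)

lemma saws_split:
  assumes "ps @ x # qs \<in> saws V E (m + n) v" "length ps = m"
  shows "ps @ [x] \<in> saws V E m v" "x # qs \<in> saws V E n x"
  using assms by (auto simp: saws_iff successively_append_iff hd_append)

lemma saws_rev:
  assumes "\<pi> \<in> saws V E n v"
  shows "rev \<pi> \<in> saws V E n (last \<pi>)"
  using assms by (auto simp: saws_iff hd_rev insert_commute)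

lemma bridges_iff:
  "\<pi> \<in> bridges V E h n v \<longleftrightarrow> \<pi> \<in> saws V E n v \<and> (\<forall>y\<in>set (tl \<pi>). h v < h y \<and> h y \<le> h (last \<pi>))"
proof -
  have "(\<forall>i\<in>{1..n}. h (\<pi> ! 0) < h (\<pi> ! i) \<and> h (\<pi> ! i) \<le> h (\<pi> ! n)) \<longleftrightarrow>
      (\<forall>y\<in>set (tl \<pi>). h v < h y \<and> h y \<le> h (last \<pi>))" if saw: "\<pi> \<in> saws V E n v"
  proof -
    obtain qs where \<pi>: "\<pi> = v # qs" "length qs = n"
      using saw by (cases \<pi>) (auto simp: saws_iff)
    have last: "last \<pi> = \<pi> ! n" using saw last_conv_nth[of \<pi>] by (cases "\<pi> = []") (auto simp: saws_iff)
    have "{1..n} = Suc ` {..<n}" by (simp add: image_Suc_lessThan)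
    then have "(\<forall>i\<in>{1..n}. P (\<pi> ! i)) \<longleftrightarrow> (\<forall>i\<in>{..<n}. P (\<pi> ! Suc i))" for P
      by (simp only: ball_simps)
    then have "(\<forall>i\<in>{1..n}. P (\<pi> ! i)) \<longleftrightarrow> (\<forall>y\<in>set (tl \<pi>). P y)" for P
      using \<pi> by (simp add: all_set_conv_all_nth lessThan_def)
    from this[of "\<lambda>y. h v < h y \<and> h y \<le> h (last \<pi>)"] show ?thesis using \<pi> last by simp
  qed
  then show ?thesis by (auto simp: bridges_def)
qed

lemma bridges_subset_saws: "bridges V E h n v \<subseteq> saws V E n v"
  by (auto simp: bridges_def)

text \<open>All heights up to \<open>x\<close> are at most \<open>h x\<close>, and all later ones
  are strictly larger. This makes the two parts disjoint and keeps the final vertex highest.\<close>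

lemma bridges_append:
  assumes 1: "ps @ [x] \<in> bridges V E h m v" and 2: "x # qs \<in> bridges V E h n x"
  shows "ps @ x # qs \<in> bridges V E h (m + n) v"
proof -
  have ps: "length ps = m" using 1 by (simp add: bridges_iff saws_iff)
  have x: "h v \<le> h x" and below: "\<forall>y\<in>set ps. h y \<le> h x"
    and above: "\<forall>y\<in>set (tl ps). h v < h y"
    and last: "ps \<noteq> [] \<Longrightarrow> h v < h x"
    using 1 by (cases ps; force simp: bridges_iff saws_iff)+
  have qs: "\<forall>y\<in>set qs. h x < h y \<and> h y \<le> h (last (x # qs))" using 2 by (simp add: bridges_iff)
  then have top: "h x \<le> h (last (x # qs))" by (cases qs) force+
  have "set ps \<inter> set (x # qs) = {}"
    using below qs 1 by (force simp: bridges_iff saws_iff)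
  then have "ps @ x # qs \<in> saws V E (m + n) v"
    using 1 2 by (auto simp: bridges_iff saws_iff successively_append_iff hd_append)
  moreover have "h v < h y \<and> h y \<le> h (last (x # qs))" if "y \<in> set (tl (ps @ x # qs))" for y
  proof -
    \<comment> \<open>If \<open>ps\<close> is empty then \<open>x\<close> is the starting vertex,
      which carries no height condition.\<close>
    consider "y \<in> set (tl ps)" | "y = x" "ps \<noteq> []" | "y \<in> set qs"
      using \<open>y \<in> set (tl (ps @ x # qs))\<close> by (cases ps) auto
    then show ?thesis
    proof cases
      case 1
      then have "y \<in> set ps" by (cases ps) auto
      then show ?thesis using 1 above below top by force
    qed (use x last qs top in force)+
  qed
  ultimately show ?thesis by (simp add: bridges_iff)
qed

section \<open>Total weights of walks and bridges in a weighted graph\<close>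

locale weighted_graph =
  fixes V :: "'v set" and E :: "'v set set" and \<phi> :: "'v set \<Rightarrow> real"
  assumes simple: "simple_graph V E" and locally_finite: "locally_finite_graph V E"
    and weight_pos: "e \<in> E \<Longrightarrow> 0 < \<phi> e"
begin

lemma edgeD:
  assumes "{x, y} \<in> E"
  shows "x \<in> V" "y \<in> V" "x \<noteq> y"
  using assms simple by (auto simp: simple_graph_def)

lemma finite_saws: "finite (saws V E n v)"
proof (induction n arbitrary: v)
  case 0
  show ?case by (simp add: saws_0)
next
  case (Suc n)
  have nbrs: "finite {u. {v, u} \<in> E}"
  proof (cases "v \<in> V")
    case False
    then have "{u. {v, u} \<in> E} = {}" using edgeD(1) by blast
    then show ?thesis by simp
  qed (use locally_finite in \<open>simp add: locally_finite_graph_def\<close>)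
  have "saws V E (Suc n) v \<subseteq> Cons v ` (\<Union>u\<in>{u. {v, u} \<in> E}. saws V E n u)"
  proof
    fix \<pi> assume "\<pi> \<in> saws V E (Suc n) v"
    then show "\<pi> \<in> Cons v ` (\<Union>u\<in>{u. {v, u} \<in> E}. saws V E n u)"
      by (auto simp: saws_iff length_Suc_conv)
  qed
  then show ?case using nbrs Suc by (meson finite_UN_I finite_imageI finite_subset)
qed

lemma finite_bridges: "finite (bridges V E h n v)"
  by (rule finite_subset[OF bridges_subset_saws finite_saws])

lemma walk_weight_saw_nonneg: "\<pi> \<in> saws V E n v \<Longrightarrow> 0 \<le> walk_weight \<phi> \<pi>"
  by (rule walk_weight_nonneg[of E]) (auto simp: saws_iff intro: less_imp_le weight_pos)

lemma walk_weight_bridge_nonneg: "\<pi> \<in> bridges V E h n v \<Longrightarrow> 0 \<le> walk_weight \<phi> \<pi>"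
  by (auto simp: bridges_def intro: walk_weight_saw_nonneg)

definition saw_weight :: "'v \<Rightarrow> nat \<Rightarrow> real" where
  "saw_weight v n = total_weight \<phi> (saws V E n v)"

lemma saw_weight_nonneg: "0 \<le> saw_weight v n"
  by (auto simp: saw_weight_def total_weight_def intro!: sum_nonneg walk_weight_saw_nonneg)

lemma saw_weight_0: "v \<in> V \<Longrightarrow> saw_weight v 0 = 1"
  by (simp add: saw_weight_def total_weight_def saws_0)

lemma bridge_weight_le_saw_weight: "total_weight \<phi> (bridges V E h n v) \<le> saw_weight v n"
  unfolding saw_weight_def total_weight_def
  by (intro sum_mono2 finite_saws bridges_subset_saws) (auto intro: walk_weight_saw_nonneg)

text \<open>Cutting after \<open>m\<close> steps maps walks injectively to pairs of walks, and
  preserves weight. Pairs that do not join to a self-avoiding walk only increase the right-hand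
  side.\<close>

lemma saw_weight_split:
  assumes s: "\<And>u. u \<in> V \<Longrightarrow> saw_weight u n \<le> s"
  shows "saw_weight v (m + n) \<le> saw_weight v m * s"
proof -
  let ?T = "SIGMA \<pi>:saws V E m v. saws V E n (last \<pi>)"
  have "saw_weight v (m + n) \<le> (\<Sum>(\<pi>, \<rho>)\<in>?T. walk_weight \<phi> \<pi> * walk_weight \<phi> \<rho>)"
    unfolding saw_weight_def total_weight_def
  \<comment> \<open>The index map rejoins a pair; \<open>butlast\<close> drops the shared vertex
    once.\<close>
  proof (rule sum_le_included[where i = "\<lambda>(\<pi>, \<rho>). butlast \<pi> @ \<rho>"])
    show "finite (saws V E (m + n) v)" "finite ?T" by (auto intro: finite_saws)
    show "\<forall>p\<in>?T. 0 \<le> (case p of (\<pi>, \<rho>) \<Rightarrow> walk_weight \<phi> \<pi> * walk_weight \<phi> \<rho>)"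
      by (auto intro!: mult_nonneg_nonneg walk_weight_saw_nonneg)
    show "\<forall>\<pi>\<in>saws V E (m + n) v. \<exists>p\<in>?T. (case p of (\<pi>, \<rho>) \<Rightarrow> butlast \<pi> @ \<rho>) = \<pi> \<and>
        walk_weight \<phi> \<pi> \<le> (case p of (\<pi>, \<rho>) \<Rightarrow> walk_weight \<phi> \<pi> * walk_weight \<phi> \<rho>)"
    proof
      fix \<pi> assume \<pi>: "\<pi> \<in> saws V E (m + n) v"
      then have "m < length \<pi>" by (simp add: saws_iff)
      then obtain ps x qs where eq: "\<pi> = ps @ x # qs" "length ps = m"
        by (metis id_take_nth_drop length_take min.absorb4)
      show "\<exists>p\<in>?T. (case p of (\<pi>, \<rho>) \<Rightarrow> butlast \<pi> @ \<rho>) = \<pi> \<and>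
        walk_weight \<phi> \<pi> \<le> (case p of (\<pi>, \<rho>) \<Rightarrow> walk_weight \<phi> \<pi> * walk_weight \<phi> \<rho>)"
        using saws_split[of ps x qs V E m n v] \<pi> eq
        by (intro bexI[of _ "(ps @ [x], x # qs)"]) (auto simp: walk_weight_append[of _ ps x qs])
    qed
  qed
  also have "\<dots> = (\<Sum>\<pi>\<in>saws V E m v. walk_weight \<phi> \<pi> * saw_weight (last \<pi>) n)"
    by (subst sum.Sigma[symmetric])
       (auto simp: saw_weight_def total_weight_def sum_distrib_left intro: finite_saws)
  also have "\<dots> \<le> (\<Sum>\<pi>\<in>saws V E m v. walk_weight \<phi> \<pi> * s)"
  proof (intro sum_mono mult_left_mono s walk_weight_saw_nonneg)
    show "last \<pi> \<in> V" if "\<pi> \<in> saws V E m v" for \<pi>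
      using that last_in_set[of \<pi>] by (cases "\<pi> = []") (auto simp: saws_iff)
  qed
  also have "\<dots> = saw_weight v m * s"
    by (simp add: saw_weight_def total_weight_def sum_distrib_right)
  finally show ?thesis .
qed

text \<open>Hammersley's trick: a walk from \<open>v\<close> visiting the neighbour \<open>u\<close> is cut there and its first part
  reversed, so that both parts start at \<open>u\<close>; a walk avoiding \<open>u\<close> is extended by the edge from \<open>u\<close>.\<close>

lemma saw_weight_adjacent:
  assumes uv: "{u, v} \<in> E"
  shows "saw_weight v n \<le> 1 / \<phi> {u, v} * saw_weight u (Suc n)
    + (\<Sum>k\<le>n. saw_weight u k * saw_weight u (n - k))"
proof -
  let ?A = "{\<pi> \<in> saws V E n v. u \<notin> set \<pi>}" and ?B = "{\<pi> \<in> saws V E n v. u \<in> set \<pi>}"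
  have \<phi>: "0 < \<phi> {u, v}" by (rule weight_pos[OF uv])
  have "sum (walk_weight \<phi>) ?A \<le> (\<Sum>\<pi>\<in>saws V E (Suc n) u. 1 / \<phi> {u, v} * walk_weight \<phi> \<pi>)"
  \<comment> \<open>Dropping the first vertex undoes the extension by \<open>u\<close>, so the
    extension is injective.\<close>
  proof (rule sum_le_included[where i = tl])
    show "\<forall>\<pi>\<in>?A. \<exists>\<rho>\<in>saws V E (Suc n) u. tl \<rho> = \<pi> \<and> walk_weight \<phi> \<pi> \<le> 1 / \<phi> {u, v} * walk_weight \<phi> \<rho>"
    proof
      fix \<pi> assume \<pi>: "\<pi> \<in> ?A"
      then obtain qs where eq: "\<pi> = v # qs" by (cases \<pi>) (auto simp: saws_iff)
      show "\<exists>\<rho>\<in>saws V E (Suc n) u. tl \<rho> = \<pi> \<and> walk_weight \<phi> \<pi> \<le> 1 / \<phi> {u, v} * walk_weight \<phi> \<rho>"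
        using \<pi> eq uv \<phi> edgeD(1)[OF uv] by (intro bexI[of _ "u # \<pi>"]) (auto simp: saws_iff)
    qed
  qed (use \<phi> in \<open>auto intro!: divide_nonneg_pos intro: finite_saws rev_finite_subset[OF finite_saws] walk_weight_saw_nonneg\<close>)
  moreover have "sum (walk_weight \<phi>) ?B \<le>
      (\<Sum>(k, \<pi>, \<rho>)\<in>(SIGMA k:{..n}. saws V E k u \<times> saws V E (n - k) u). walk_weight \<phi> \<pi> * walk_weight \<phi> \<rho>)"
    (is "_ \<le> sum ?g ?T")
  \<comment> \<open>The index map reverses the first part back and removes its copy of
    \<open>u\<close>.\<close>
  proof (rule sum_le_included[where i = "\<lambda>(k, \<pi>, \<rho>). rev (tl \<pi>) @ \<rho>"])
    show "\<forall>\<pi>\<in>?B. \<exists>p\<in>?T. (case p of (k, \<pi>, \<rho>) \<Rightarrow> rev (tl \<pi>) @ \<rho>) = \<pi> \<and> walk_weight \<phi> \<pi> \<le> ?g p"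
    proof
      fix \<pi> assume \<pi>: "\<pi> \<in> ?B"
      then obtain ps qs where eq: "\<pi> = ps @ u # qs" by (auto dest: split_list)
      have len: "n = length ps + length qs" using \<pi> eq by (simp add: saws_iff)
      have "ps @ [u] \<in> saws V E (length ps) v" "u # qs \<in> saws V E (length qs) u"
        using saws_split[of ps u qs V E "length ps" "length qs" v] \<pi> eq len by auto
      moreover have "rev (ps @ [u]) \<in> saws V E (length ps) u"
        using saws_rev[OF calculation(1)] by simp
      moreover have "walk_weight \<phi> \<pi> = walk_weight \<phi> (rev (ps @ [u])) * walk_weight \<phi> (u # qs)"
        unfolding walk_weight_rev eq by (rule walk_weight_append)
      ultimately show "\<exists>p\<in>?T. (case p of (k, \<pi>, \<rho>) \<Rightarrow> rev (tl \<pi>) @ \<rho>) = \<pi> \<and> walk_weight \<phi> \<pi> \<le> ?g p"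
        using eq len by (intro bexI[of _ "(length ps, rev (ps @ [u]), u # qs)"]) auto
    qed
  qed (auto intro!: finite_saws finite_SigmaI mult_nonneg_nonneg walk_weight_saw_nonneg)
  moreover have "sum ?g ?T = (\<Sum>k\<le>n. saw_weight u k * saw_weight u (n - k))"
    by (subst sum.Sigma[symmetric])
       (auto simp: finite_saws saw_weight_def total_weight_def sum_product sum.cartesian_product)
  moreover have "saw_weight v n = sum (walk_weight \<phi>) ?A + sum (walk_weight \<phi>) ?B"
    unfolding saw_weight_def total_weight_def
    by (subst sum.union_disjoint[symmetric]) (auto intro: rev_finite_subset[OF finite_saws[of n v]] sum.cong)
  ultimately show ?thesis by (simp add: saw_weight_def total_weight_def sum_distrib_left)
qed

text \<open>Here the inequality is opposite to the one for self-avoiding walks: any two bridges that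
  meet can be joined, and cutting at step \<open>m\<close> recovers the pair.\<close>

lemma bridge_weight_append:
  assumes b: "\<And>u. u \<in> V \<Longrightarrow> b \<le> total_weight \<phi> (bridges V E h n u)"
  shows "total_weight \<phi> (bridges V E h m v) * b \<le> total_weight \<phi> (bridges V E h (m + n) v)"
proof -
  let ?T = "SIGMA \<pi>:bridges V E h m v. bridges V E h n (last \<pi>)"
  have "total_weight \<phi> (bridges V E h m v) * b
      \<le> (\<Sum>\<pi>\<in>bridges V E h m v. walk_weight \<phi> \<pi> * total_weight \<phi> (bridges V E h n (last \<pi>)))"
    unfolding total_weight_def[of \<phi> "bridges V E h m v"] sum_distrib_right
  proof (intro sum_mono mult_left_mono b walk_weight_bridge_nonneg)
    show "last \<pi> \<in> V" if "\<pi> \<in> bridges V E h m v" for \<pi>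
      using that last_in_set[of \<pi>] by (cases "\<pi> = []") (auto simp: bridges_iff saws_iff)
  qed
  also have "\<dots> = (\<Sum>(\<pi>, \<rho>)\<in>?T. walk_weight \<phi> \<pi> * walk_weight \<phi> \<rho>)"
    by (subst sum.Sigma[symmetric]) (auto simp: total_weight_def sum_distrib_left intro: finite_bridges)
  also have "\<dots> \<le> total_weight \<phi> (bridges V E h (m + n) v)"
    unfolding total_weight_def
  proof (rule sum_le_included[where i = "\<lambda>\<pi>. (take (Suc m) \<pi>, drop m \<pi>)"])
    show "\<forall>p\<in>?T. \<exists>\<pi>\<in>bridges V E h (m + n) v. (take (Suc m) \<pi>, drop m \<pi>) = p \<and>
        (case p of (\<pi>, \<rho>) \<Rightarrow> walk_weight \<phi> \<pi> * walk_weight \<phi> \<rho>) \<le> walk_weight \<phi> \<pi>"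
    proof
      fix p assume p: "p \<in> ?T"
      then obtain \<pi> \<rho> where \<pi>\<rho>: "p = (\<pi>, \<rho>)" "\<pi> \<in> bridges V E h m v" "\<rho> \<in> bridges V E h n (last \<pi>)"
        by auto
      obtain ps x where ps: "\<pi> = ps @ [x]" "length ps = m"
        using \<pi>\<rho>(2) by (cases \<pi> rule: rev_cases) (auto simp: bridges_iff saws_iff)
      obtain qs where qs: "\<rho> = x # qs"
        using \<pi>\<rho>(3) ps by (cases \<rho>) (auto simp: bridges_iff saws_iff)
      show "\<exists>\<pi>\<in>bridges V E h (m + n) v. (take (Suc m) \<pi>, drop m \<pi>) = p \<and>
        (case p of (\<pi>, \<rho>) \<Rightarrow> walk_weight \<phi> \<pi> * walk_weight \<phi> \<rho>) \<le> walk_weight \<phi> \<pi>"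
        using bridges_append[of ps x V E h m v qs n] \<pi>\<rho> ps qs
        by (intro bexI[of _ "ps @ x # qs"]) (auto simp: walk_weight_append[of _ ps x qs])
    qed
  qed (auto intro: finite_bridges finite_SigmaI walk_weight_bridge_nonneg)
  finally show ?thesis .
qed

text \<open>Mapping walks along \<open>\<alpha>\<close> is injective and preserves weight. One
  inequality suffices, since it is used only to bound all vertices by orbit representatives.\<close>

lemma saw_weight_automorphism:
  assumes \<alpha>: "\<alpha> \<in> carrier (graph_aut V E)"
    and inv: "\<And>x y. {x, y} \<in> E \<Longrightarrow> \<phi> {\<alpha> x, \<alpha> y} = \<phi> {x, y}"
  shows "saw_weight v n \<le> saw_weight (\<alpha> v) n"
proof -
  have bij: "bij_betw \<alpha> V V" and aut: "\<And>x y. x \<in> V \<Longrightarrow> y \<in> V \<Longrightarrow> {\<alpha> x, \<alpha> y} \<in> E \<longleftrightarrow> {x, y} \<in> E"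
    using \<alpha> by (auto simp: graph_aut_def Bij_def)
  have adj: "{\<alpha> x, \<alpha> y} \<in> E" if "{x, y} \<in> E" for x y using aut that edgeD by blast
  have weight: "successively (\<lambda>x y. {x, y} \<in> E) \<pi> \<Longrightarrow> walk_weight \<phi> (map \<alpha> \<pi>) = walk_weight \<phi> \<pi>" for \<pi>
    by (induction \<pi> rule: induct_list012) (simp_all add: inv)
  show ?thesis
    unfolding saw_weight_def total_weight_def
  proof (rule sum_le_included[where i = "map (inv_into V \<alpha>)"])
    show "\<forall>\<pi>\<in>saws V E n v. \<exists>\<rho>\<in>saws V E n (\<alpha> v). map (inv_into V \<alpha>) \<rho> = \<pi> \<and> walk_weight \<phi> \<pi> \<le> walk_weight \<phi> \<rho>"
    proof
      fix \<pi> assume \<pi>: "\<pi> \<in> saws V E n v"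
      have sub: "set \<pi> \<subseteq> V" using \<pi> by (simp add: saws_iff)
      then have inj: "inj_on \<alpha> (set \<pi>)" using bij by (meson bij_betw_imp_inj_on inj_on_subset)
      have "map \<alpha> \<pi> \<in> saws V E n (\<alpha> v)"
        using \<pi> inj bij_betw_imp_surj_on[OF bij]
        by (cases "\<pi> = []") (auto simp: saws_iff distinct_map successively_map hd_map intro: adj successively_mono)
      moreover have "map (inv_into V \<alpha>) (map \<alpha> \<pi>) = \<pi>"
        using sub bij by (auto simp: bij_betw_inv_into_left intro!: map_idI)
      ultimately show "\<exists>\<rho>\<in>saws V E n (\<alpha> v). map (inv_into V \<alpha>) \<rho> = \<pi> \<and> walk_weight \<phi> \<pi> \<le> walk_weight \<phi> \<rho>"
        using weight[of \<pi>] \<pi> by (intro bexI[of _ "map \<alpha> \<pi>"]) (auto simp: saws_iff)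
    qed
  qed (auto intro: finite_saws walk_weight_saw_nonneg)
qed

end

section \<open>Existence of the limits\<close>

locale weighted_height_graph =
  fixes V :: "'v set" and E :: "'v set set" and r :: 'v and h :: "'v \<Rightarrow> int"
    and H :: "('v \<Rightarrow> 'v) set" and \<phi> :: "'v set \<Rightarrow> real"
  assumes simple_graph: "simple_graph V E" and locally_finite_graph: "locally_finite_graph V E"
    and connected: "connected_graph V E" and root: "r \<in> V"
    and height: "graph_height_function V E r h H" and weight: "\<phi> \<in> weight_functions E H"

sublocale weighted_height_graph \<subseteq> weighted_graph V E \<phi>
  using simple_graph locally_finite_graph weight
  by unfold_locales (auto simp: weight_functions_def)

context weighted_height_graph
begin

section \<open>Minimal edge weight and growth of bridges\<close>

lemma ascending_edge:
  assumes "v \<in> V"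
  obtains w where "{v, w} \<in> E" "h v < h w"
  using assms height unfolding graph_height_function_def by meson

lemma edges_nonempty: "E \<noteq> {}"
  using ascending_edge[OF root] by blast

lemma finite_values: "finite (\<phi> ` E)"
  by (rule finite_weight_values[OF simple_graph locally_finite_graph height weight])

lemma weight_min_le: "e \<in> E \<Longrightarrow> weight_min E \<phi> \<le> \<phi> e"
  unfolding weight_min_def using finite_values by (intro cINF_lower bdd_below_finite)

lemma weight_min_pos: "0 < weight_min E \<phi>"
proof -
  have "weight_min E \<phi> \<in> \<phi> ` E"
    unfolding weight_min_def using finite_values edges_nonempty by (subst cInf_eq_Min) auto
  then show ?thesis using weight_pos by auto
qed

lemma bridge_weight_nonneg: "0 \<le> total_weight \<phi> (bridges V E h n v)"
  by (auto simp: total_weight_def intro!: sum_nonneg walk_weight_bridge_nonneg)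

lemma min_bridge_weight_le: "v \<in> V \<Longrightarrow> min_bridge_weight V E h \<phi> n \<le> total_weight \<phi> (bridges V E h n v)"
  unfolding min_bridge_weight_def
  by (rule cINF_lower[OF bdd_belowI2[of _ 0]]) (auto intro: bridge_weight_nonneg)

lemma min_bridge_weight_greatest:
  "(\<And>v. v \<in> V \<Longrightarrow> x \<le> total_weight \<phi> (bridges V E h n v)) \<Longrightarrow> x \<le> min_bridge_weight V E h \<phi> n"
  unfolding min_bridge_weight_def using root by (intro cINF_greatest) auto

lemma min_bridge_weight_supermult:
  "min_bridge_weight V E h \<phi> m * min_bridge_weight V E h \<phi> n \<le> min_bridge_weight V E h \<phi> (m + n)"
proof (rule min_bridge_weight_greatest)
  fix v assume v: "v \<in> V"
  have "min_bridge_weight V E h \<phi> m * min_bridge_weight V E h \<phi> n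
      \<le> total_weight \<phi> (bridges V E h m v) * min_bridge_weight V E h \<phi> n"
    by (intro mult_right_mono min_bridge_weight_le[OF v] min_bridge_weight_greatest bridge_weight_nonneg)
  also have "\<dots> \<le> total_weight \<phi> (bridges V E h (m + n) v)"
    by (rule bridge_weight_append) (rule min_bridge_weight_le)
  finally show "min_bridge_weight V E h \<phi> m * min_bridge_weight V E h \<phi> n \<le> total_weight \<phi> (bridges V E h (m + n) v)" .
qed

text \<open>An ascending edge is a one-step bridge, available at every vertex; supermultiplicativity
  chains \<open>n\<close> of them.\<close>

lemma power_weight_min_le: "weight_min E \<phi> ^ n \<le> min_bridge_weight V E h \<phi> n"
proof (induction n)
  case 0
  show ?case
    by (rule min_bridge_weight_greatest) (simp add: bridges_def saws_0 total_weight_def)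
next
  case (Suc n)
  have "weight_min E \<phi> \<le> min_bridge_weight V E h \<phi> 1"
  proof (rule min_bridge_weight_greatest)
    fix v assume v: "v \<in> V"
    obtain w where w: "{v, w} \<in> E" "h v < h w" using ascending_edge[OF v] .
    have "weight_min E \<phi> \<le> walk_weight \<phi> [v, w]" using weight_min_le[OF w(1)] by simp
    also have "\<dots> \<le> total_weight \<phi> (bridges V E h 1 v)"
      unfolding total_weight_def
      by (rule member_le_sum[OF _ walk_weight_bridge_nonneg[where h = h and n = 1 and v = v] finite_bridges])
         (use w edgeD[OF w(1)] in \<open>auto simp: bridges_iff saws_iff\<close>)
    finally show "weight_min E \<phi> \<le> total_weight \<phi> (bridges V E h 1 v)" .
  qed
  then have "weight_min E \<phi> ^ Suc n \<le> min_bridge_weight V E h \<phi> 1 * min_bridge_weight V E h \<phi> n"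
    unfolding power_Suc using Suc weight_min_pos by (intro mult_mono) auto
  then show ?case using min_bridge_weight_supermult[of 1 n] by simp
qed

lemma min_bridge_weight_pos: "0 < min_bridge_weight V E h \<phi> n"
  using power_weight_min_le[of n] zero_less_power[OF weight_min_pos, of n] by linarith

text \<open>A single representative \<open>w\<close> dominates \<open>v\<close> at all lengths
  simultaneously, so the maximum over \<open>V\<close> reduces to one over a finite set.\<close>

lemma orbit_representatives:
  obtains W where "finite W" "W \<subseteq> V" "\<And>v. v \<in> V \<Longrightarrow> \<exists>w\<in>W. \<forall>n. saw_weight v n \<le> saw_weight w n"
proof -
  have sub: "subgroup H (graph_aut V E)" and qt: "quasi_transitive_action V H"
    using height by (simp_all only: graph_height_function_def)
  obtain W where W: "finite W" "W \<subseteq> V" "\<forall>v\<in>V. \<exists>\<alpha>\<in>H. \<alpha> v \<in> W"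
    using qt unfolding quasi_transitive_action_def by metis
  have "\<exists>w\<in>W. \<forall>n. saw_weight v n \<le> saw_weight w n" if v: "v \<in> V" for v
  proof -
    obtain \<alpha> where \<alpha>: "\<alpha> \<in> H" "\<alpha> v \<in> W" using bspec[OF W(3) v] by (rule bexE)
    have "\<alpha> \<in> carrier (graph_aut V E)" using subgroup.subset[OF sub] \<alpha>(1) by (rule subsetD)
    moreover have "\<phi> {\<alpha> x, \<alpha> y} = \<phi> {x, y}" if "{x, y} \<in> E" for x y
      using weight \<alpha>(1) that unfolding weight_functions_def by blast
    ultimately have "\<forall>n. saw_weight v n \<le> saw_weight (\<alpha> v) n" by (blast intro: saw_weight_automorphism)
    with \<alpha>(2) show ?thesis by blast
  qed
  with that W(1,2) show ?thesis by blast
qed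

lemma submultiplicative_bound:
  obtains W s where "finite W" "W \<subseteq> V" "\<And>n. \<exists>w\<in>W. saw_weight w n = s n"
    "\<And>v n. v \<in> V \<Longrightarrow> saw_weight v n \<le> s n" "\<And>m n. s (m + n) \<le> s m * s n"
    "\<And>n. weight_min E \<phi> ^ n \<le> s n" "s 0 = 1"
proof -
  obtain W where W: "finite W" "W \<subseteq> V" "\<And>v. v \<in> V \<Longrightarrow> \<exists>w\<in>W. \<forall>n. saw_weight v n \<le> saw_weight w n"
    using orbit_representatives by metis
  define s where "s n = Max ((\<lambda>w. saw_weight w n) ` W)" for n
  have ne: "W \<noteq> {}" using W(3)[OF root] by blast
  have att: "\<exists>w\<in>W. saw_weight w n = s n" for n
  proof -
    have "s n \<in> (\<lambda>w. saw_weight w n) ` W" unfolding s_def using W(1) ne by (intro Max_in) auto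
    then show ?thesis by auto
  qed
  have le: "saw_weight v n \<le> s n" if v: "v \<in> V" for v n
  proof -
    obtain w where w: "w \<in> W" "saw_weight v n \<le> saw_weight w n" using W(3)[OF v] by blast
    have "saw_weight w n \<le> s n" unfolding s_def using W(1) w(1) by (intro Max_ge) auto
    with w(2) show ?thesis by linarith
  qed
  have nonneg: "0 \<le> s n" for n using le[OF root, of n] saw_weight_nonneg[of r n] by linarith
  have sub: "s (m + n) \<le> s m * s n" for m n
  proof -
    obtain w where w: "w \<in> W" "saw_weight w (m + n) = s (m + n)" using att by blast
    have "s (m + n) \<le> saw_weight w m * s n" using saw_weight_split[OF le, of w m n] w(2) by simp
    also have "\<dots> \<le> s m * s n" using le w(1) W(2) nonneg by (intro mult_right_mono) auto
    finally show ?thesis .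
  qed
  have low: "weight_min E \<phi> ^ n \<le> s n" for n
    \<comment> \<open>Bridges are self-avoiding walks, so their lower bound passes to the
      maximum.\<close>
    using power_weight_min_le[of n] min_bridge_weight_le[OF root, of n]
      bridge_weight_le_saw_weight[of h n r] le[OF root, of n] by linarith
  have "s 0 = 1" using att[of 0] saw_weight_0 W(2) by force
  with that W(1,2) att le sub low show ?thesis by blast
qed

text \<open>\<open>L\<close> is the growth rate of the maximum \<open>s\<close>. After division by
  \<open>L ^ n\<close>, Hammersley's argument shows that the root \<open>r\<close> grows at the same
  rate.\<close>

lemma saw_weight_limit:
  obtains L where "0 < L" "(\<lambda>n. root n (saw_weight r n)) \<longlonglongrightarrow> L"
proof -
  obtain W s where W: "finite W" "W \<subseteq> V" "\<And>n. \<exists>w\<in>W. saw_weight w n = s n"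
    and le: "\<And>v n. v \<in> V \<Longrightarrow> saw_weight v n \<le> s n" and sub: "\<And>m n. s (m + n) \<le> s m * s n"
    and low: "\<And>n. weight_min E \<phi> ^ n \<le> s n" using submultiplicative_bound by metis
  obtain L where L: "weight_min E \<phi> \<le> L" "\<And>n. L ^ n \<le> s n"
    "\<And>x. L < x \<Longrightarrow> \<exists>C>0. \<forall>n. s n \<le> C * x ^ n"
    using submultiplicative_limit[of s, OF sub weight_min_pos low] by metis
  have Lpos: "0 < L" using L(1) weight_min_pos by linarith
  define R where "R = {(u, v). u \<in> V \<and> v \<in> V \<and> (u = v \<or> {u, v} \<in> E)}"
  interpret hammersley "\<lambda>v n. saw_weight v n / L ^ n" "\<lambda>n. s n / L ^ n" R "L / weight_min E \<phi>"
  proof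
    show "0 \<le> saw_weight v n / L ^ n" for v n using Lpos saw_weight_nonneg by simp
    show "0 \<le> L / weight_min E \<phi>" using Lpos weight_min_pos by simp
    show "0 < s n / L ^ n" for n
      using L(2)[of n] zero_less_power[OF Lpos, of n] by (intro divide_pos_pos) linarith+
    show "saw_weight u n / L ^ n \<le> s n / L ^ n" if "(u, v) \<in> R" for u v n
      using that le Lpos by (simp add: R_def divide_right_mono)
    show "saw_weight u (m + n) / L ^ (m + n) \<le> saw_weight u m / L ^ m * (s n / L ^ n)"
      if "(u, v) \<in> R" for u v m n
      using saw_weight_split[OF le, of u m n] Lpos by (simp add: power_add divide_right_mono)
    show "\<exists>C>0. \<forall>n. s n / L ^ n \<le> C * x ^ n" if "1 < x" for x
    proof -
      have "L < x * L" using that Lpos by simp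
      from L(3)[OF this] obtain C where "0 < C" "\<And>n. s n \<le> C * (x * L) ^ n" by blast
      then show ?thesis
        using Lpos by (intro exI[of _ C]) (simp add: power_mult_distrib divide_le_eq mult.assoc)
    qed
    show "saw_weight v n / L ^ n \<le> L / weight_min E \<phi> * (saw_weight u (Suc n) / L ^ Suc n) +
        (\<Sum>k\<le>n. saw_weight u k / L ^ k * (saw_weight u (n - k) / L ^ (n - k)))"
      if R: "(u, v) \<in> R" for u v n
    proof -
      let ?S = "\<Sum>k\<le>n. saw_weight u k * saw_weight u (n - k)"
      have "saw_weight v n \<le> 1 / weight_min E \<phi> * saw_weight u (Suc n) + ?S"
      proof (cases "u = v")
        case True
        \<comment> \<open>For a loop, the term \<open>k = 0\<close> alone is
          \<open>saw_weight u n\<close>, because the trivial walk has weight 1.\<close>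
        have "saw_weight u 0 * saw_weight u (n - 0) \<le> ?S"
          by (rule member_le_sum) (auto intro: saw_weight_nonneg mult_nonneg_nonneg)
        moreover have "0 \<le> 1 / weight_min E \<phi> * saw_weight u (Suc n)"
          using weight_min_pos saw_weight_nonneg by simp
        ultimately show ?thesis using R True by (simp add: R_def saw_weight_0)
      next
        case False
        then have uv: "{u, v} \<in> E" using R by (simp add: R_def)
        have "1 / \<phi> {u, v} * saw_weight u (Suc n) \<le> 1 / weight_min E \<phi> * saw_weight u (Suc n)"
          by (intro mult_right_mono saw_weight_nonneg divide_left_mono)
             (use weight_min_le[OF uv] weight_min_pos weight_pos[OF uv] in auto)
        then show ?thesis using saw_weight_adjacent[OF uv, of n] by linarith
      qed
      then have "saw_weight v n / L ^ n \<le> (1 / weight_min E \<phi> * saw_weight u (Suc n) + ?S) / L ^ n"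
        using Lpos by (intro divide_right_mono) auto
      also have "\<dots> = L / weight_min E \<phi> * (saw_weight u (Suc n) / L ^ Suc n) + ?S / L ^ n"
        using Lpos by (simp add: add_divide_distrib)
      also have "?S / L ^ n = (\<Sum>k\<le>n. saw_weight u k / L ^ k * (saw_weight u (n - k) / L ^ (n - k)))"
        unfolding sum_divide_distrib by (intro sum.cong) (auto simp flip: power_add)
      finally show ?thesis .
    qed
  qed
  have R_refl: "(v, v) \<in> R \<longleftrightarrow> v \<in> V" for v by (simp add: R_def)
  have fast: "\<forall>\<^sub>F n in sequentially. q ^ n \<le> saw_weight r n / L ^ n" if "0 < q" "q < 1" for q
  proof (rule eventually_fast[OF W(1)])
    show "\<exists>w\<in>W. 1 \<le> saw_weight w n / L ^ n" for n
    proof -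
      obtain w where "w \<in> W" "saw_weight w n = s n" using W(3) by blast
      then show ?thesis using L(2)[of n] Lpos by (intro bexI[of _ w]) simp_all
    qed
    show "(r, w) \<in> R\<^sup>*" if "w \<in> W" for w
    proof -
      have "(r, w) \<in> {(x, y). {x, y} \<in> E}\<^sup>*"
        using connected root W(2) that unfolding connected_graph_def by blast
      moreover have "{(x, y). {x, y} \<in> E} \<subseteq> R" using edgeD by (auto simp: R_def)
      ultimately show ?thesis using rtrancl_mono by blast
    qed
    show "(v, v) \<in> R" if "(u, v) \<in> R" for u v using that by (auto simp: R_def)
  qed (use root that R_refl in auto)
  have "(\<lambda>n. root n (saw_weight r n)) \<longlonglongrightarrow> L"
  proof (rule root_tendsto_sandwich[OF Lpos])
    show "\<forall>\<^sub>F n in sequentially. (q * L) ^ n \<le> saw_weight r n" if "0 < q" "q < 1" for q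
      using fast[OF that] by eventually_elim (use Lpos in \<open>simp add: power_mult_distrib le_divide_eq\<close>)
    show "\<exists>C>0. \<forall>n. saw_weight r n \<le> C * x ^ n" if "L < x" for x
      using L(3)[OF that] le[OF root] order_trans by meson
  qed
  with that Lpos show ?thesis by blast
qed

text \<open>Inversion turns the supermultiplicative sequence into a submultiplicative one. Its
  positive lower bound comes from the upper bound \<open>s 1 ^ n\<close> on all walks.\<close>

lemma min_bridge_weight_limit:
  obtains L where "0 < L" "(\<lambda>n. root n (min_bridge_weight V E h \<phi> n)) \<longlonglongrightarrow> L"
proof -
  let ?b = "min_bridge_weight V E h \<phi>"
  obtain W s where le: "\<And>v n. v \<in> V \<Longrightarrow> saw_weight v n \<le> s n" and sub: "\<And>m n. s (m + n) \<le> s m * s n"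
    and low: "\<And>n. weight_min E \<phi> ^ n \<le> s n" and s0: "s 0 = 1" using submultiplicative_bound by metis
  have pos: "0 < s n" for n using low[of n] zero_less_power[OF weight_min_pos, of n] by linarith
  have "s n \<le> s 1 ^ n" for n
  proof (induction n)
    case (Suc n)
    have "s (Suc n) \<le> s 1 * s n" using sub[of 1 n] by simp
    also have "\<dots> \<le> s 1 ^ Suc n" using Suc pos[of 1] by simp
    finally show ?case .
  qed (simp add: s0)
  then have up: "?b n \<le> s 1 ^ n" for n
    using min_bridge_weight_le[OF root, of n] bridge_weight_le_saw_weight[of h n r] le[OF root, of n]
    by (meson order_trans)
  have 1: "inverse (?b (m + n)) \<le> inverse (?b m) * inverse (?b n)" for m n
    using min_bridge_weight_supermult[of m n] min_bridge_weight_pos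
    by (simp flip: inverse_mult_distrib add: le_imp_inverse_le)
  have 2: "inverse (s 1) ^ n \<le> inverse (?b n)" for n
    using up[of n] min_bridge_weight_pos[of n] by (simp add: power_inverse le_imp_inverse_le)
  have "0 < inverse (s 1)" using pos[of 1] by simp
  from submultiplicative_limit[of "\<lambda>n. inverse (?b n)", OF 1 this 2]
  obtain L where L: "inverse (s 1) \<le> L" "(\<lambda>n. root n (inverse (?b n))) \<longlonglongrightarrow> L" by metis
  have Lpos: "0 < L" using L(1) \<open>0 < inverse (s 1)\<close> by linarith
  have "(\<lambda>n. root n (?b n)) \<longlonglongrightarrow> inverse L"
    using tendsto_inverse[OF L(2)] Lpos by (simp add: real_root_inverse)
  with that[of "inverse L"] Lpos show ?thesis by simp
qed

text \<open>\<open>lim\<close> denotes the actual limit only once convergence is known, which is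
  supplied here.\<close>

lemma connective_const_pos: "0 < connective_const V E r \<phi>"
  and connective_const_limit:
    "(\<lambda>n. root n (total_weight \<phi> (saws V E n r))) \<longlonglongrightarrow> connective_const V E r \<phi>"
  using saw_weight_limit limI unfolding connective_const_def saw_weight_def by metis+

lemma bridge_const_pos: "0 < bridge_const V E h \<phi>"
  and bridge_const_limit:
    "(\<lambda>n. root n (min_bridge_weight V E h \<phi> n)) \<longlonglongrightarrow> bridge_const V E h \<phi>"
  using min_bridge_weight_limit limI unfolding bridge_const_def by metis+

end

section \<open>Comparison of two weight functions\<close>

lemma root_limit_le:
  fixes f g :: "nat \<Rightarrow> real"
  assumes "(\<lambda>n. root n (f n)) \<longlonglongrightarrow> x" "(\<lambda>n. root n (g n)) \<longlonglongrightarrow> y"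
    and "0 \<le> c" "\<And>n. f n \<le> c ^ n * g n"
  shows "x \<le> c * y"
proof (rule tendsto_le[OF sequentially_bot tendsto_mult_left[OF assms(2)] assms(1)])
  show "\<forall>\<^sub>F n in sequentially. root n (f n) \<le> c * root n (g n)"
    using eventually_gt_at_top[of 0]
  proof eventually_elim
    case (elim n)
    have "root n (f n) \<le> root n (c ^ n * g n)" using elim assms(4) by simp
    also have "\<dots> = c * root n (g n)"
      using elim assms(3) by (simp add: real_root_mult real_root_power_cancel)
    finally show ?case .
  qed
qed

lemma total_weight_le:
  assumes "P \<subseteq> saws V E n v" "c \<ge> 0"
    and "\<And>e. e \<in> E \<Longrightarrow> 0 \<le> \<phi> e" "\<And>e. e \<in> E \<Longrightarrow> 0 \<le> \<psi> e" "\<And>e. e \<in> E \<Longrightarrow> \<psi> e \<le> c * \<phi> e"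
  shows "total_weight \<psi> P \<le> c ^ n * total_weight \<phi> P"
  unfolding total_weight_def sum_distrib_left
proof (rule sum_mono)
  fix \<pi> assume "\<pi> \<in> P"
  then have "\<pi> \<in> saws V E n v" using assms(1) by blast
  then show "walk_weight \<psi> \<pi> \<le> c ^ n * walk_weight \<phi> \<pi>"
    using walk_weight_le[of E \<phi> \<psi> c \<pi>] assms by (simp add: saws_iff)
qed

locale two_weights =
  A: weighted_height_graph V E r h H \<phi> + B: weighted_height_graph V E r h H \<psi>
  for V :: "'v set" and E r h H \<phi> \<psi>
begin

lemma scaled_weights_le:
  assumes c: "0 < c" and le: "\<And>e. e \<in> E \<Longrightarrow> \<psi> e \<le> c * \<phi> e"
  shows "connective_const V E r \<psi> \<le> c * connective_const V E r \<phi>"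
    and "bridge_const V E h \<psi> \<le> c * bridge_const V E h \<phi>"
proof -
  have tw: "total_weight \<psi> P \<le> c ^ n * total_weight \<phi> P" if "P \<subseteq> saws V E n v" for P n v
    by (rule total_weight_le[OF that]) (use c le A.weight_pos B.weight_pos in \<open>auto intro: less_imp_le\<close>)
  show "connective_const V E r \<psi> \<le> c * connective_const V E r \<phi>"
    by (rule root_limit_le[OF B.connective_const_limit A.connective_const_limit]) (use c tw in auto)
  have "min_bridge_weight V E h \<psi> n \<le> c ^ n * min_bridge_weight V E h \<phi> n" for n
  proof -
    \<comment> \<open>Division by \<open>c ^ n\<close> puts the claim into the form of a lower bound
      for an infimum, to be checked vertex by vertex.\<close>
    have "min_bridge_weight V E h \<psi> n / c ^ n \<le> min_bridge_weight V E h \<phi> n"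
    proof (rule A.min_bridge_weight_greatest)
      fix v assume "v \<in> V"
      then show "min_bridge_weight V E h \<psi> n / c ^ n \<le> total_weight \<phi> (bridges V E h n v)"
        using B.min_bridge_weight_le[of v n] tw[OF bridges_subset_saws, of h n v] c
        by (simp add: divide_le_eq mult.commute)
    qed
    then show ?thesis using c by (simp add: divide_le_eq mult.commute)
  qed
  then show "bridge_const V E h \<psi> \<le> c * bridge_const V E h \<phi>"
    using c by (intro root_limit_le[OF B.bridge_const_limit A.bridge_const_limit]) auto
qed

text \<open>Converts the additive distance into a relative error, using
  \<open>weight_min E \<phi> \<le> \<phi> e\<close>.\<close>

lemma abs_diff_le:
  assumes "e \<in> E"
  shows "\<bar>\<psi> e - \<phi> e\<bar> \<le> dsup E \<psi> \<phi> / weight_min E \<phi> * \<phi> e"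
proof -
  \<comment> \<open>Both weights take finitely many values, so the supremum in \<open>dsup\<close>
    is over a bounded set.\<close>
  have "(\<lambda>e. \<bar>\<psi> e - \<phi> e\<bar>) ` E \<subseteq> (\<lambda>(x, y). \<bar>x - y\<bar>) ` (\<psi> ` E \<times> \<phi> ` E)" by auto
  then have "finite ((\<lambda>e. \<bar>\<psi> e - \<phi> e\<bar>) ` E)"
    by (rule finite_subset) (auto intro: A.finite_values B.finite_values)
  then have d: "\<bar>\<psi> e - \<phi> e\<bar> \<le> dsup E \<psi> \<phi>"
    unfolding dsup_def using assms by (intro cSUP_upper bdd_above_finite)
  have "dsup E \<psi> \<phi> = dsup E \<psi> \<phi> / weight_min E \<phi> * weight_min E \<phi>"
    using A.weight_min_pos by simp
  also have "\<dots> \<le> dsup E \<psi> \<phi> / weight_min E \<phi> * \<phi> e"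
    using d A.weight_min_pos by (intro mult_left_mono A.weight_min_le[OF assms] divide_nonneg_pos) linarith+
  finally show ?thesis using d by linarith
qed

end

text \<open>Exchanging the two weights lets the same comparison deliver the lower bounds on the
  ratios.\<close>

sublocale two_weights \<subseteq> swapped: two_weights V E r h H \<psi> \<phi> ..

context two_weights
begin

lemma ratio_bounds:
  defines "t \<equiv> dsup E \<psi> \<phi> / weight_min E \<phi>"
  shows "1 - t \<le> connective_const V E r \<psi> / connective_const V E r \<phi>"
    and "connective_const V E r \<psi> / connective_const V E r \<phi> \<le> 1 + t"
    and "1 - t \<le> bridge_const V E h \<psi> / bridge_const V E h \<phi>"
    and "bridge_const V E h \<psi> / bridge_const V E h \<phi> \<le> 1 + t"
proof -
  note pos = A.connective_const_pos B.connective_const_pos A.bridge_const_pos B.bridge_const_pos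
  have diff: "\<bar>\<psi> e - \<phi> e\<bar> \<le> t * \<phi> e" if "e \<in> E" for e
    unfolding t_def by (rule abs_diff_le[OF that])
  obtain e where e: "e \<in> E" using A.edges_nonempty by blast
  have t: "0 \<le> t" using diff[OF e] A.weight_pos[OF e] by (smt (verit) mult_neg_pos)
  have "\<psi> e \<le> (1 + t) * \<phi> e" if "e \<in> E" for e using diff[OF that] by (simp add: distrib_right)
  from scaled_weights_le[OF _ this]
  show "connective_const V E r \<psi> / connective_const V E r \<phi> \<le> 1 + t"
    "bridge_const V E h \<psi> / bridge_const V E h \<phi> \<le> 1 + t"
    using t pos by (simp_all add: divide_le_eq)
  have "1 - t \<le> connective_const V E r \<psi> / connective_const V E r \<phi> \<and>
    1 - t \<le> bridge_const V E h \<psi> / bridge_const V E h \<phi>"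
  \<comment> \<open>For \<open>t < 1\<close> the bound \<open>(1 - t) * \<phi> \<le> \<psi>\<close>
    can be inverted; otherwise \<open>1 - t\<close> is not positive and the ratios are.\<close>
  proof (cases "t < 1")
    case True
    have "\<phi> e \<le> 1 / (1 - t) * \<psi> e" if "e \<in> E" for e
      using diff[OF that] True by (simp add: le_divide_eq algebra_simps)
    from swapped.scaled_weights_le[OF _ this] show ?thesis
      using True pos by (simp add: le_divide_eq divide_le_eq mult.commute)
  next
    case False
    moreover have "0 < connective_const V E r \<psi> / connective_const V E r \<phi>"
      "0 < bridge_const V E h \<psi> / bridge_const V E h \<phi>" using pos by simp_all
    ultimately show ?thesis by linarith
  qed
  then show "1 - t \<le> connective_const V E r \<psi> / connective_const V E r \<phi>"
    "1 - t \<le> bridge_const V E h \<psi> / bridge_const V E h \<phi>" by simp_all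
qed

end

section \<open>From ratio bounds to continuity\<close>

lemma continuous_map_of_ratio_bounds:
  fixes F :: "'b \<Rightarrow> real"
  assumes F: "\<And>x. x \<in> mspace m \<Longrightarrow> 0 < F x" and c: "\<And>x. x \<in> mspace m \<Longrightarrow> 0 < c x"
    and ratio: "\<And>x y. x \<in> mspace m \<Longrightarrow> y \<in> mspace m \<Longrightarrow>
      1 - mdist m y x / c x \<le> F y / F x \<and> F y / F x \<le> 1 + mdist m y x / c x"
  shows "continuous_map (mtopology_of m) euclideanreal F"
proof -
  have "\<exists>\<delta>>0. \<forall>y. y \<in> mspace m \<and> mdist m x y < \<delta> \<longrightarrow> dist (F x) (F y) < \<epsilon>"
    if x: "x \<in> mspace m" and \<epsilon>: "0 < \<epsilon>" for x \<epsilon>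
  \<comment> \<open>The ratio bounds give
    \<open>\<bar>F y - F x\<bar> \<le> F x * mdist m y x / c x\<close>; this radius makes the
    right-hand side smaller than \<open>\<epsilon>\<close>. It may depend on \<open>x\<close>, as
    continuity is pointwise.\<close>
  proof (intro exI[of _ "\<epsilon> * c x / F x"] conjI allI impI)
    show "0 < \<epsilon> * c x / F x" using F[OF x] c[OF x] \<epsilon> by simp
    fix y assume y: "y \<in> mspace m \<and> mdist m x y < \<epsilon> * c x / F x"
    have "\<bar>F y / F x - 1\<bar> \<le> mdist m y x / c x" using ratio[OF x] y by force
    also have "\<dots> < \<epsilon> / F x" using y F[OF x] c[OF x] by (simp add: mdist_commute field_simps)
    finally have "\<bar>F y / F x - 1\<bar> * F x < \<epsilon>" using F[OF x] by (simp add: less_divide_eq)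
    moreover have "\<bar>F y / F x - 1\<bar> * F x = \<bar>F y - F x\<bar>"
      using F[OF x] by (simp add: abs_mult_pos left_diff_distrib)
    ultimately show "dist (F x) (F y) < \<epsilon>" by (simp add: dist_real_def abs_minus_commute)
  qed
  then show ?thesis
    unfolding mtopology_of_def mtopology_is_euclidean[symmetric]
    by (subst Metric_space.metric_continuous_map[OF Metric_space_mspace_mdist Met_TC.Metric_space_axioms]) auto
qed

theorem theorem2p7:
  fixes V :: "'a set" and E :: "'a set set" and r :: 'a
    and h :: "'a \<Rightarrow> int" and H :: "('a \<Rightarrow> 'a) set"
  assumes "simple_graph V E"
    and "connected_graph V E"
    and "infinite V"
    and "quasi_transitive_graph V E"
    and "locally_finite_graph V E"
    and "r \<in> V"
    and "graph_height_function V E r h H"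
  shows "continuous_map (mtopology_of (weight_metric E H)) euclideanreal
           (connective_const V E r) \<and>
         continuous_map (mtopology_of (weight_metric E H)) euclideanreal
           (bridge_const V E h) \<and>
         (\<forall>\<phi>\<in>weight_functions E H. \<forall>\<psi>\<in>weight_functions E H.
           1 - dsup E \<psi> \<phi> / weight_min E \<phi>
             \<le> connective_const V E r \<psi> / connective_const V E r \<phi> \<and>
           connective_const V E r \<psi> / connective_const V E r \<phi>
             \<le> 1 + dsup E \<psi> \<phi> / weight_min E \<phi> \<and>
           1 - dsup E \<psi> \<phi> / weight_min E \<phi>
             \<le> bridge_const V E h \<psi> / bridge_const V E h \<phi> \<and>
           bridge_const V E h \<psi> / bridge_const V E h \<phi>
             \<le> 1 + dsup E \<psi> \<phi> / weight_min E \<phi>)"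
proof -
  have W: "weighted_height_graph V E r h H \<phi>" if "\<phi> \<in> weight_functions E H" for \<phi>
    using assms that by unfold_locales
  then have two: "two_weights V E r h H \<phi> \<psi>"
    if "\<phi> \<in> weight_functions E H" "\<psi> \<in> weight_functions E H" for \<phi> \<psi>
    using that by (simp add: two_weights_def)
  have ms: "mspace (weight_metric E H) = weight_functions E H"
    by (rule mspace_weight_metric[OF assms(1,5,7)])
  have md: "mdist (weight_metric E H) \<psi> \<phi> = dsup E \<psi> \<phi>"
    if "\<phi> \<in> weight_functions E H" "\<psi> \<in> weight_functions E H" for \<phi> \<psi>
    by (rule mdist_weight_metric[OF assms(1,5,7) weighted_height_graph.edges_nonempty[OF W[OF that(1)]] that(2,1)])
  note bounds = two_weights.ratio_bounds[OF two]
  have "continuous_map (mtopology_of (weight_metric E H)) euclideanreal (connective_const V E r)"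
    by (rule continuous_map_of_ratio_bounds[where c = "weight_min E"])
       (simp_all add: ms md bounds W weighted_height_graph.connective_const_pos[OF W] weighted_height_graph.weight_min_pos[OF W])
  moreover have "continuous_map (mtopology_of (weight_metric E H)) euclideanreal (bridge_const V E h)"
    by (rule continuous_map_of_ratio_bounds[where c = "weight_min E"])
       (simp_all add: ms md bounds W weighted_height_graph.bridge_const_pos[OF W] weighted_height_graph.weight_min_pos[OF W])
  ultimately show ?thesis using bounds by blast
qed

end
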